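(* With $t_m=m(m+1)/2$ denoting the $m$-th triangular number, $$ g(t_n,t_{n+1},t_{n+2};2)=\begin{cases} \dfrac{(5 n-3)(n+1)(n+2)}{4}-1&\text{if $n\ge 5$ is odd};\\[2mm] \dfrac{5 n(n+1)(n+2)}{4}-1&\text{if $n\ge 2$ is even}\,. \end{cases} $$
   Context: For positive integers $a_1,\dots,a_k$ with $\gcd(a_1,\dots,a_k)=1$ and an integer $N$, let $d(N;a_1,\dots,a_k)$ denote the number of $k$-tuples $(x_1,\dots,x_k)$ of nonnegative integers with $a_1x_1+\cdots+a_kx_k=N$. For a nonnegative integer $q$, $g(a_1,\dots,a_k;q)$ denotes the largest integer $N$ such that $d(N;a_1,\dots,a_k)\le q$. It is known that $\gcd(t_n,t_{n+1},t_{n+2})=1$. *)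

theory Defs
  imports Complex_Main
begin

definition triangular :: "nat \<Rightarrow> nat" where
  "triangular m = m * (m + 1) div 2"

text \<open>
  The tuples \<open>(a\<^sub>1, \<dots>, a\<^sub>k)\<close> and \<open>(x\<^sub>1, \<dots>, x\<^sub>k)\<close> are lists of the same length. The set below is
  finite when all entries of \<open>as\<close> are positive (lemma \<open>finite_representations\<close>); otherwise
  \<open>card\<close> may take its default value \<open>0\<close> on an infinite set.
\<close>

definition representations :: "int \<Rightarrow> nat list \<Rightarrow> nat list set" where
  "representations N as =
     {xs. length xs = length as \<and> (\<Sum>i<length as. int (as ! i) * int (xs ! i)) = N}"

definition denumerant :: "int \<Rightarrow> nat list \<Rightarrow> nat" where
  "denumerant N as = card (representations N as)"

text \<open>
  The largest element is taken over all integers, so negative \<open>N\<close>, for which the denumerant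
  is \<open>0\<close>, are included. The value is unspecified if there is no largest such \<open>N\<close>.
\<close>

definition frobenius :: "nat list \<Rightarrow> nat \<Rightarrow> int" where
  "frobenius as q = (GREATEST N::int. denumerant N as \<le> q)"

lemma finite_representations:
  assumes "\<And>a. a \<in> set as \<Longrightarrow> 0 < a"
  shows "finite (representations N as)"
proof (rule finite_subset)
  show "representations N as \<subseteq> {xs. set xs \<subseteq> {..nat N} \<and> length xs = length as}"
  proof
    fix xs assume xs: "xs \<in> representations N as"
    then have len: "length xs = length as"
      and eq: "(\<Sum>i<length as. int (as ! i) * int (xs ! i)) = N"
      by (auto simp: representations_def)
    have "x \<le> nat N" if "x \<in> set xs" for x
    proof -
      from that obtain j where j: "j < length as" "x = xs ! j"
        using len by (metis in_set_conv_nth)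
      have "1 \<le> as ! j" using assms[of "as ! j"] j(1) by simp
      then have "int x \<le> int (as ! j) * int (xs ! j)" using j(2) by (simp flip: of_nat_mult)
      also have "\<dots> \<le> N"
        unfolding eq[symmetric] using j(1) by (intro member_le_sum) auto
      finally show ?thesis by linarith
    qed
    then show "xs \<in> {xs. set xs \<subseteq> {..nat N} \<and> length xs = length as}"
      using len by auto
  qed
qed (rule finite_lists_length_eq, simp)

lemma frobenius_eqI:
  assumes "denumerant N as \<le> q" and "\<And>M. denumerant M as \<le> q \<Longrightarrow> M \<le> N"
  shows "frobenius as q = N"
  unfolding frobenius_def using assms by (rule Greatest_equality)

end

theory Submission imports Defs "HOL-Number_Theory.Cong" begin

text \<open>
  Two of three consecutive triangular numbers are \<open>B p\<close> and \<open>B (p + 1)\<close>, where \<open>B\<close> is odd and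
  coprime to the third one, \<open>e\<close>: the first two for even \<open>n\<close>, the last two for odd \<open>n\<close>. Every integer
  is uniquely \<open>B M + e z\<close> with \<open>0 \<le> z < B\<close>, and its denumerant with respect to
  \<open>e, B p, B (p + 1)\<close> is that of \<open>M\<close> with respect to \<open>e, p, p + 1\<close>. Hence the \<open>q\<close>-Frobenius number
  is \<open>B G + (B - 1) e\<close>, where \<open>G\<close> is the one for \<open>e, p, p + 1\<close>. Since \<open>p x + (p + 1) y = p s + y\<close>
  with \<open>s = x + y \<ge> y\<close>, the representations by \<open>p\<close> and \<open>p + 1\<close> correspond to the \<open>s\<close> with
  \<open>s p \<le> M \<le> s (p + 1)\<close>. There are two of them for \<open>M = G\<close>, where no representation uses \<open>e\<close>.
  For \<open>M > G\<close> there are three when \<open>n\<close> is even; when \<open>n\<close> is odd, two of them and one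
  representation that uses \<open>e\<close> once suffice.
\<close>

section \<open>Representations under consing, scaling and rotation of the coefficient list\<close>

lemma representations_Nil: "representations N [] = (if N = 0 then {[]} else {})"
  by (auto simp: representations_def)

lemma Cons_in_representations_iff:
  "x # xs \<in> representations N (a # as) \<longleftrightarrow> xs \<in> representations (N - int a * int x) as"
  by (auto simp: representations_def sum.lessThan_Suc_shift simp del: sum.lessThan_Suc)

lemma representations_Cons:
  "representations N (a # as) = {x # xs | x xs. xs \<in> representations (N - int a * int x) as}"
proof (intro set_eqI)
  fix ys
  show "ys \<in> representations N (a # as)
    \<longleftrightarrow> ys \<in> {x # xs | x xs. xs \<in> representations (N - int a * int x) as}"
    by (cases ys) (simp add: representations_def, simp add: Cons_in_representations_iff)
qed

lemma representations_map_mult: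
  assumes "0 < B"
  shows "xs \<in> representations (int B * N) (map ((*) B) as) \<longleftrightarrow> xs \<in> representations N as"
proof -
  have "(\<Sum>i<length as. int (map ((*) B) as ! i) * int (xs ! i))
      = int B * (\<Sum>i<length as. int (as ! i) * int (xs ! i))"
    by (simp add: sum_distrib_left mult.assoc)
  with assms show ?thesis
    by (simp add: representations_def)
qed

lemma dvd_if_representations_map_mult:
  assumes "xs \<in> representations N (map ((*) B) as)"
  shows "int B dvd N"
  using assms by (auto simp: representations_def intro!: dvd_sum)

text \<open>Needed for even \<open>n\<close>, where the entry coprime to \<open>B\<close> comes
  last, while the reduction expects it at the head.\<close>

lemma denumerant_rotate: "denumerant N (as @ [a]) = denumerant N (a # as)"
proof -
  have "bij_betw (\<lambda>xs. last xs # butlast xs) (representations N (as @ [a])) (representations N (a # as))"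
  proof (rule bij_betw_byWitness[where f' = "\<lambda>xs. tl xs @ [hd xs]"])
    have append: "xs @ [x] \<in> representations N (as @ [a]) \<longleftrightarrow> x # xs \<in> representations N (a # as)" for x xs
    proof -
      have "(\<Sum>i<length (as @ [a]). int ((as @ [a]) ! i) * int ((xs @ [x]) ! i))
          = int a * int x + (\<Sum>i<length as. int (as ! i) * int (xs ! i))" if "length xs = length as"
        using that by (simp add: nth_append cong: sum.cong_simp)
      then show ?thesis
        by (auto simp: Cons_in_representations_iff) (auto simp: representations_def)
    qed
    have ne: "xs \<noteq> []" if "xs \<in> representations N (as @ [a]) \<or> xs \<in> representations N (a # as)" for xs
      using that by (auto simp: representations_def)
    show "\<forall>xs\<in>representations N (as @ [a]). tl (last xs # butlast xs) @ [hd (last xs # butlast xs)] = xs"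
      using ne by simp
    show "\<forall>xs\<in>representations N (a # as). last (tl xs @ [hd xs]) # butlast (tl xs @ [hd xs]) = xs"
      using ne by simp
    show "(\<lambda>xs. last xs # butlast xs) ` representations N (as @ [a]) \<subseteq> representations N (a # as)"
    proof safe
      fix xs assume xs: "xs \<in> representations N (as @ [a])"
      then have "butlast xs @ [last xs] = xs" using ne by simp
      with xs show "last xs # butlast xs \<in> representations N (a # as)"
        using append by metis
    qed
    show "(\<lambda>xs. tl xs @ [hd xs]) ` representations N (a # as) \<subseteq> representations N (as @ [a])"
    proof safe
      fix xs assume xs: "xs \<in> representations N (a # as)"
      then have "hd xs # tl xs = xs" using ne by simp
      with xs show "tl xs @ [hd xs] \<in> representations N (as @ [a])"
        using append by metis
    qed
  qed
  then show ?thesis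
    unfolding denumerant_def by (rule bij_betw_same_card)
qed

section \<open>Removing the common factor \<open>B\<close>\<close>

text \<open>Modulo \<open>B\<close> only the head term survives, so coprimality forces its
  coefficient to be \<open>z + B * k\<close>. Subtracting \<open>e z\<close> and dividing by
  \<open>B\<close> turns the representation into one of \<open>M\<close> with head coefficient
  \<open>k\<close>.\<close>

lemma denumerant_coprime_reduction:
  assumes "coprime e B" and "z < B"
  shows "denumerant (int B * M + int e * int z) (e # map ((*) B) as) = denumerant M (e # as)"
proof -
  let ?N = "int B * M + int e * int z"
  let ?f = "\<lambda>xs. (z + B * hd xs) # tl xs"
  have B: "0 < B" using assms by simp
  have shift: "(z + B * k) # xs \<in> representations ?N (e # map ((*) B) as)
      \<longleftrightarrow> k # xs \<in> representations M (e # as)" for k xs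
  proof -
    have "?N - int e * int (z + B * k) = int B * (M - int e * int k)"
      by (simp add: algebra_simps)
    then show ?thesis
      by (simp only: Cons_in_representations_iff representations_map_mult[OF B])
  qed
  have "bij_betw ?f (representations M (e # as)) (representations ?N (e # map ((*) B) as))"
  proof (rule bij_betw_imageI)
    show "inj_on ?f (representations M (e # as))"
      using B by (auto simp: inj_on_def representations_Cons)
    show "?f ` representations M (e # as) = representations ?N (e # map ((*) B) as)"
    proof (intro equalityI subsetI)
      fix ys assume "ys \<in> ?f ` representations M (e # as)"
      then obtain k xs where "ys = (z + B * k) # xs" "k # xs \<in> representations M (e # as)"
        by (force simp: representations_Cons)
      then show "ys \<in> representations ?N (e # map ((*) B) as)"
        using shift by simp
    next
      fix ys assume ys: "ys \<in> representations ?N (e # map ((*) B) as)"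
      then obtain x xs where x: "ys = x # xs"
        and "xs \<in> representations (?N - int e * int x) (map ((*) B) as)"
        by (auto simp: representations_Cons)
      then have "int B dvd ?N - int e * int x"
        by (intro dvd_if_representations_map_mult)
      then have "int B dvd int e * (int z - int x) + int B * M"
        by (simp add: algebra_simps)
      then have "int B dvd int e * (int z - int x)"
        using dvd_add_left_iff dvd_triv_left by blast
      with assms(1) have "int B dvd int z - int x"
        by (simp add: coprime_commute coprime_dvd_mult_right_iff)
      then have "[int x = int z] (mod int B)"
        by (simp add: cong_iff_dvd_diff dvd_diff_commute)
      then have "x mod B = z"
        using assms(2) by (simp only: cong_int_iff) (simp add: cong_def)
      then have "x = z + B * (x div B)"
        by (metis mod_mult_div_eq)
      with ys x shift have "ys = ?f (x div B # xs)" and "x div B # xs \<in> representations M (e # as)"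
        by (auto, metis)
      then show "ys \<in> ?f ` representations M (e # as)"
        by blast
    qed
  qed
  then show ?thesis
    unfolding denumerant_def by (metis bij_betw_same_card)
qed

text \<open>In \<open>N = B M + e z\<close> the bounds \<open>M \<le> G\<close> and
  \<open>z \<le> B - 1\<close> are independent, so the maximum is attained where both are
  equalities.\<close>

lemma frobenius_coprime_reduction:
  assumes "coprime e B" and "0 < B"
    and le: "denumerant G (e # as) \<le> q" and gt: "\<And>M. G < M \<Longrightarrow> q < denumerant M (e # as)"
  shows "frobenius (e # map ((*) B) as) q = int B * G + int e * (int B - 1)"
proof (rule frobenius_eqI)
  have "int B * G + int e * (int B - 1) = int B * G + int e * int (B - 1)"
    using assms(2) by (simp add: of_nat_diff)
  then show "denumerant (int B * G + int e * (int B - 1)) (e # map ((*) B) as) \<le> q"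
    using denumerant_coprime_reduction[of e B "B - 1" G as] assms by simp
next
  fix N assume N: "denumerant N (e # map ((*) B) as) \<le> q"
  from assms(1) obtain w where w: "[int e * w = N] (mod int B)"
    using cong_solve_coprime_int[of "int e" "int B"]
    by (metis cong_scalar_right coprime_int_iff mult.assoc mult_1)
  define z where "z = nat (w mod int B)"
  have z: "int z = w mod int B" and "z < B"
    using assms(2) by (simp_all add: z_def nat_less_iff)
  have "[int e * int z = N] (mod int B)"
    using w unfolding z cong_def by (simp add: mod_mult_right_eq)
  then obtain M where M: "N = int B * M + int e * int z"
    by (metis cong_iff_lin add.commute)
  have "M \<le> G"
    using N gt[of M] denumerant_coprime_reduction[OF assms(1) \<open>z < B\<close>, of M as] M by fastforce
  then have "int B * M \<le> int B * G"
    by (simp add: mult_left_mono)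
  moreover have "int e * int z \<le> int e * (int B - 1)"
    using \<open>z < B\<close> by (intro mult_left_mono) auto
  ultimately show "N \<le> int B * G + int e * (int B - 1)"
    using M by linarith
qed

section \<open>Counting representations by \<open>e\<close>, \<open>p\<close> and
  \<open>p + 1\<close>\<close>

lemma representations_3:
  "representations M [e, a, b] = {[k, x, y] | k x y. int e * int k + int a * int x + int b * int y = M}"
  by (auto simp: representations_Cons representations_Nil)

text \<open>Once \<open>k = 0\<close>, the sum \<open>s = x + y\<close> determines
  \<open>y = M - p s\<close> and then \<open>x\<close>, so there are at most as many representations
  as values of \<open>s\<close>.\<close>

lemma denumerant_consecutive_le_2:
  assumes "\<And>k s y :: nat. y \<le> s \<Longrightarrow> int e * int k + int p * int s + int y = M
      \<Longrightarrow> k = 0 \<and> (s = u \<or> s = Suc u)"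
  shows "denumerant M [e, p, p + 1] \<le> 2"
proof -
  have *: "k = 0 \<and> (x + y = u \<or> x + y = Suc u)"
    if "int e * int k + int p * int x + int (p + 1) * int y = M" for k x y
    using that by (intro assms[of y "x + y" k]) (auto simp: algebra_simps)
  have "inj_on (\<lambda>xs. xs ! 1 + xs ! 2) (representations M [e, p, p + 1])"
  proof (rule inj_onI)
    fix xs ys
    assume xs: "xs \<in> representations M [e, p, p + 1]" and ys: "ys \<in> representations M [e, p, p + 1]"
      and eq: "xs ! 1 + xs ! 2 = ys ! 1 + ys ! 2"
    from xs obtain k x y where x: "xs = [k, x, y]"
      "int e * int k + int p * int x + int (p + 1) * int y = M"
      by (auto simp: representations_3)
    from ys obtain k' x' y' where y: "ys = [k', x', y']"
      "int e * int k' + int p * int x' + int (p + 1) * int y' = M"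
      by (auto simp: representations_3)
    have k: "k = 0" "k' = 0" using * x(2) y(2) by blast+
    have s: "x + y = x' + y'" using eq x(1) y(1) by simp
    have "int p * int (x + y) + int y = int p * int (x' + y') + int y'"
      using x(2) y(2) k by (simp add: algebra_simps)
    then have "y = y'" using s by simp
    with s k x(1) y(1) show "xs = ys" by simp
  qed
  moreover have "(\<lambda>xs. xs ! 1 + xs ! 2) ` representations M [e, p, p + 1] \<subseteq> {u, Suc u}"
  proof safe
    fix xs assume "xs \<in> representations M [e, p, p + 1]" and "xs ! 1 + xs ! 2 \<noteq> u"
    then show "xs ! 1 + xs ! 2 = Suc u"
      unfolding representations_3 using * by fastforce
  qed
  ultimately have "card (representations M [e, p, p + 1]) \<le> card {u, Suc u}"
    by (intro card_inj_on_le) auto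
  then show ?thesis
    by (simp add: denumerant_def)
qed

lemma consecutive_representation:
  assumes "M = int e * int k + int p * int s + int y" and "y \<le> s"
  shows "[k, s - y, y] \<in> representations M [e, p, p + 1]"
  using assms by (auto simp: representations_3 of_nat_diff algebra_simps)

lemma two_less_denumerant:
  assumes "\<And>a. a \<in> set as \<Longrightarrow> 0 < a" and "xs \<in> representations M as" "ys \<in> representations M as"
    "zs \<in> representations M as" and "xs \<noteq> ys" "xs \<noteq> zs" "ys \<noteq> zs"
  shows "2 < denumerant M as"
proof -
  have "card {xs, ys, zs} \<le> card (representations M as)"
    using assms by (intro card_mono finite_representations) auto
  then show ?thesis
    using assms(5-7) by (simp add: denumerant_def)
qed

text \<open>Supplies the starting pair \<open>s = q\<close>, \<open>y = r\<close>; here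
  \<open>q\<close> is the largest \<open>s\<close> with \<open>p s \<le> M\<close>.\<close>

lemma quotient_remainder:
  assumes "0 < p" and "int p * int u \<le> M"
  obtains q r where "M = int p * int q + int r" "r < p" "u \<le> q"
proof
  have "0 \<le> M" using assms(2) by (meson of_nat_0_le_iff order_trans zero_le_mult_iff)
  then have M: "M = int (nat M)" by simp
  show "M = int p * int (nat M div p) + int (nat M mod p)"
    using M by (metis mult_div_mod_eq of_nat_add of_nat_mult)
  show "nat M mod p < p" using assms by simp
  have "p * u \<le> nat M" using assms(2) \<open>0 \<le> M\<close> by (simp add: le_nat_iff)
  then show "u \<le> nat M div p" using assms(1) by (simp add: less_eq_div_iff_mult_less_eq mult.commute)
qed

section \<open>The extremal value for \<open>e = (p + 1) (2 p + 3)\<close>\<close>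

lemma denumerant_even_case_le:
  assumes "0 < p" and e: "e = (p + 1) * (2 * p + 3)"
  shows "denumerant (3 * int p * (int p + 1) - 2 * int p - 1) [e, p, p + 1] \<le> 2"
proof (rule denumerant_consecutive_le_2[where u = "3 * p - 1"])
  fix k s y :: nat
  assume "y \<le> s" and eq: "int e * int k + int p * int s + int y = 3 * int p * (int p + 1) - 2 * int p - 1"
  \<comment> \<open>Working in \<open>int\<close> avoids truncation of differences such as
    \<open>P - 5\<close> for small \<open>p\<close>; the products \<open>P * P\<close> and
    \<open>P * S\<close> act as atoms for linear arithmetic.\<close>
  define P S where "P = int p" and "S = int s"
  have P: "1 \<le> P" using assms(1) by (simp add: P_def)
  have y: "int y \<le> S" "0 \<le> int y" using \<open>y \<le> s\<close> by (auto simp: S_def)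
  have E: "int e = 2 * (P * P) + 5 * P + 3" by (simp add: e P_def algebra_simps)
  have eq': "int e * int k + P * S + int y = 3 * (P * P) + P - 1"
    using eq by (simp add: P_def S_def algebra_simps)
  have PS: "0 \<le> P * S" by (simp add: P_def S_def)
  have "0 < P * P" using P by simp
  have k1: "k \<le> 1"
  proof (rule ccontr)
    assume "\<not> k \<le> 1"
    then have "int e * 2 \<le> int e * int k" by (intro mult_left_mono) auto
    then show False using eq' E P PS y \<open>0 < P * P\<close> by linarith
  qed
  have k0: "k = 0"
  proof (rule ccontr)
    assume "k \<noteq> 0"
    with k1 have "k = 1" by simp
    \<comment> \<open>The remaining value lies in a gap: it is one more than
      \<open>(P - 5) (P + 1)\<close>, the most that \<open>S = P - 5\<close> reaches, and less than
      \<open>P (P - 4)\<close>, the least for \<open>S = P - 4\<close>.\<close>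
    then have eq1: "P * S + int y = P * P - 4 * P - 4" using eq' E by simp
    then have "P * S < P * (P - 4)" using y by (simp add: algebra_simps)
    then have "S \<le> P - 5" using P by (simp add: mult_less_cancel_left_pos)
    moreover from this have "P * S \<le> P * (P - 5)" using P by (intro mult_left_mono) auto
    ultimately show False using eq1 y by (simp add: algebra_simps)
  qed
  have eq0: "P * S + int y = 3 * (P * P) + P - 1" using eq' k0 by simp
  \<comment> \<open>The least value for \<open>S = 3 P + 1\<close> is one too large, and the
    greatest value for \<open>S = 3 P - 2\<close> is one too small.\<close>
  then have "P * S < P * (3 * P + 1)" using y by (simp add: algebra_simps)
  then have "S \<le> 3 * P" using P by (simp add: mult_less_cancel_left_pos)
  moreover have "3 * P - 1 \<le> S"
  proof (rule ccontr)
    assume "\<not> 3 * P - 1 \<le> S"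
    then have "S \<le> 3 * P - 2" by simp
    moreover from this have "P * S \<le> P * (3 * P - 2)" using P by (intro mult_left_mono) auto
    ultimately show False using eq0 y by (simp add: algebra_simps)
  qed
  ultimately show "k = 0 \<and> (s = 3 * p - 1 \<or> s = Suc (3 * p - 1))"
    using k0 assms(1) by (auto simp: P_def S_def)
qed

lemma denumerant_consecutive_gt:
  assumes "0 < p" and "0 < e" and "3 * int p * (int p + 1) - 2 * int p - 1 < M"
  shows "2 < denumerant M [e, p, p + 1]"
proof -
  \<comment> \<open>The strict lower bound on \<open>M\<close> is exactly
    \<open>p (3 p + 1) - 1\<close>.\<close>
  have "int p * int (3 * p + 1) \<le> M"
    using assms(3) by (simp add: algebra_simps)
  then obtain q r where M: "M = int p * int q + int r" "r < p" "3 * p + 1 \<le> q"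
    by (rule quotient_remainder[OF assms(1)])
  \<comment> \<open>Lowering \<open>s\<close> by one and raising \<open>y\<close> by
    \<open>p\<close> preserves \<open>p s + y\<close>. For \<open>i = 2\<close> the condition
    \<open>y \<le> s\<close> follows from \<open>r + 2 p \<le> 3 p - 1 \<le> q - 2\<close>.\<close>
  have rep: "[0, q - i - (r + i * p), r + i * p] \<in> representations M [e, p, p + 1]" if "i \<le> 2" for i
  proof (rule consecutive_representation)
    have i: "i = 0 \<or> i = 1 \<or> i = 2" using that by linarith
    then show "M = int e * int 0 + int p * int (q - i) + int (r + i * p)"
      using M by (auto simp: of_nat_diff algebra_simps)
    show "r + i * p \<le> q - i"
      using i M by auto
  qed
  show ?thesis
    by (rule two_less_denumerant[OF _ rep[of 0] rep[of 1] rep[of 2]]) (use assms in auto)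
qed

section \<open>The extremal value for \<open>e = p (2 p - 1)\<close>\<close>

lemma denumerant_odd_case_le:
  assumes "2 \<le> p" and e: "e = p * (2 * p - 1)"
  shows "denumerant (3 * int p * int p - 2 * int p - 1) [e, p, p + 1] \<le> 2"
proof (rule denumerant_consecutive_le_2[where u = "3 * p - 4"])
  fix k s y :: nat
  assume "y \<le> s" and eq: "int e * int k + int p * int s + int y = 3 * int p * int p - 2 * int p - 1"
  define P S where "P = int p" and "S = int s"
  have P: "2 \<le> P" using assms(1) by (simp add: P_def)
  have y: "int y \<le> S" "0 \<le> int y" using \<open>y \<le> s\<close> by (auto simp: S_def)
  have E: "int e = 2 * (P * P) - P" using assms(1) by (simp add: e P_def of_nat_diff algebra_simps)
  have eq': "int e * int k + P * S + int y = 3 * (P * P) - 2 * P - 1"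
    using eq by (simp add: P_def S_def algebra_simps)
  have PS: "0 \<le> P * S" by (simp add: P_def S_def)
  have "0 < P * P" using P by simp
  have k1: "k \<le> 1"
  proof (rule ccontr)
    assume "\<not> k \<le> 1"
    then have "int e * 2 \<le> int e * int k" by (intro mult_left_mono) auto
    then show False using eq' E P PS y \<open>0 < P * P\<close> by linarith
  qed
  have k0: "k = 0"
  proof (rule ccontr)
    assume "k \<noteq> 0"
    with k1 have "k = 1" by simp
    \<comment> \<open>What remains is the classical Frobenius number of \<open>p\<close> and
      \<open>p + 1\<close>, hence not representable by them.\<close>
    then have eq1: "P * S + int y = P * P - P - 1" using eq' E by simp
    then have "P * S < P * (P - 1)" using y by (simp add: algebra_simps)
    then have "S \<le> P - 2" using P by (simp add: mult_less_cancel_left_pos)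
    moreover from this have "P * S \<le> P * (P - 2)" using P by (intro mult_left_mono) auto
    ultimately show False using eq1 y by (simp add: algebra_simps)
  qed
  have eq0: "P * S + int y = 3 * (P * P) - 2 * P - 1" using eq' k0 by simp
  \<comment> \<open>\<open>S = 3 P - 2\<close> already gives at least one too much, and
    \<open>S = 3 P - 5\<close> gives at most \<open>3 * (P * P) - 2 * P - 5\<close>, which is too
    little.\<close>
  then have "P * S < P * (3 * P - 2)" using y by (simp add: algebra_simps)
  then have "S \<le> 3 * P - 3" using P by (simp add: mult_less_cancel_left_pos)
  moreover have "3 * P - 4 \<le> S"
  proof (rule ccontr)
    assume "\<not> 3 * P - 4 \<le> S"
    then have "S \<le> 3 * P - 5" by simp
    moreover from this have "P * S \<le> P * (3 * P - 5)" using P by (intro mult_left_mono) auto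
    ultimately show False using eq0 y by (simp add: algebra_simps)
  qed
  ultimately show "k = 0 \<and> (s = 3 * p - 4 \<or> s = Suc (3 * p - 4))"
    using k0 assms(1) by (auto simp: P_def S_def)
qed

lemma denumerant_odd_case_gt:
  assumes "2 \<le> p" and e: "e = p * (2 * p - 1)" and "3 * int p * int p - 2 * int p - 1 < M"
  shows "2 < denumerant M [e, p, p + 1]"
proof -
  have "int p * int (3 * p - 2) \<le> M"
    using assms by (simp add: of_nat_diff algebra_simps)
  then obtain q r where M: "M = int p * int q + int r" "r < p" "3 * p - 2 \<le> q"
    using assms(1) by (elim quotient_remainder[rotated]) auto
  have "[0, q - r, r] \<in> representations M [e, p, p + 1]"
    by (rule consecutive_representation) (use M assms(1) in auto)
  moreover have "[0, q - 1 - (r + p), r + p] \<in> representations M [e, p, p + 1]"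
    by (rule consecutive_representation) (use M assms(1) in \<open>auto simp: of_nat_diff algebra_simps\<close>)
  \<comment> \<open>As \<open>e = p (2 p - 1)\<close>, one copy of \<open>e\<close> replaces
    \<open>2 p - 1\<close> units of \<open>s\<close> with \<open>y = r\<close> unchanged. The bound
    \<open>3 p - 2 \<le> q\<close> leaves \<open>s \<ge> p - 1 \<ge> r\<close>.\<close>
  moreover have "[1, q - (2 * p - 1) - r, r] \<in> representations M [e, p, p + 1]"
    by (rule consecutive_representation) (use M assms(1) e in \<open>auto simp: of_nat_diff algebra_simps\<close>)
  ultimately show ?thesis
    by (rule two_less_denumerant[rotated]) (use assms in auto)
qed

section \<open>Application to triangular numbers\<close>

lemma triangular_double: "triangular (2 * m) = (2 * m + 1) * m"
  by (simp add: triangular_def)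

lemma triangular_double_plus_1: "triangular (2 * m + 1) = (2 * m + 1) * (m + 1)"
proof -
  have "(2 * m + 1) * (2 * m + 1 + 1) = 2 * ((2 * m + 1) * (m + 1))" by simp
  then show ?thesis unfolding triangular_def by (metis nonzero_mult_div_cancel_left zero_neq_numeral)
qed

text \<open>Here \<open>p = m\<close> and \<open>B = 2 m + 1\<close>. Coprimality holds because
  \<open>2 (m + 1) - B = 1\<close>, and because \<open>2 m + 3\<close> and the odd number
  \<open>B\<close> differ by 2.\<close>

lemma frobenius_triangular_even:
  assumes "0 < m"
  shows "frobenius [triangular (2 * m), triangular (2 * m + 1), triangular (2 * m + 2)] 2
    = 5 * int m * (int m + 1) * (2 * int m + 1) - 1"
proof -
  let ?B = "2 * m + 1" and ?e = "(m + 1) * (2 * m + 3)"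
  have list: "[triangular (2 * m), triangular (2 * m + 1), triangular (2 * m + 2)]
      = map ((*) ?B) [m, m + 1] @ [?e]"
    using triangular_double[of m] triangular_double_plus_1[of m] triangular_double[of "m + 1"]
    by (simp add: algebra_simps)
  have "coprime ?B (m + 1)"
  proof (rule coprimeI)
    fix d assume "d dvd ?B" "d dvd m + 1"
    then have "d dvd 2 * (m + 1) - ?B" by (metis dvd_diff_nat dvd_mult)
    then show "is_unit d" by simp
  qed
  moreover have "coprime ?B (2 * m + 3)"
  proof (rule coprimeI)
    fix d assume d: "d dvd ?B" "d dvd 2 * m + 3"
    then have "d dvd (2 * m + 3) - ?B" by (metis dvd_diff_nat)
    then have "d dvd 2" by simp
    then have "d dvd ?B - 2 * m" using d(1) by (metis dvd_diff_nat dvd_mult2)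
    then show "is_unit d" by simp
  qed
  ultimately have "coprime ?e ?B"
    unfolding coprime_mult_left_iff by (simp only: coprime_commute)
  have "frobenius (map ((*) ?B) [m, m + 1] @ [?e]) 2 = frobenius (?e # map ((*) ?B) [m, m + 1]) 2"
    unfolding frobenius_def denumerant_rotate ..
  also have "\<dots> = int ?B * (3 * int m * (int m + 1) - 2 * int m - 1) + int ?e * (int ?B - 1)"
    using assms \<open>coprime ?e ?B\<close> denumerant_even_case_le[of m ?e]
    by (intro frobenius_coprime_reduction denumerant_consecutive_gt) auto
  also have "\<dots> = 5 * int m * (int m + 1) * (2 * int m + 1) - 1"
    by (simp add: algebra_simps)
  finally show ?thesis
    unfolding list .
qed

text \<open>Here \<open>p = m + 1\<close> and \<open>B = 2 m + 3\<close>, so \<open>0 < m\<close>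
  provides the \<open>2 \<le> p\<close> of the bounds. The factor \<open>2 m + 1\<close> of
  \<open>e\<close> is written as \<open>2 (m + 1) - 1\<close> to match their shape
  \<open>p * (2 * p - 1)\<close>.\<close>

lemma frobenius_triangular_odd:
  assumes "0 < m"
  shows "frobenius [triangular (2 * m + 1), triangular (2 * m + 2), triangular (2 * m + 3)] 2
    = (5 * int m + 1) * (int m + 1) * (2 * int m + 3) - 1"
proof -
  let ?B = "2 * m + 3" and ?e = "(m + 1) * (2 * (m + 1) - 1)"
  have "2 * m + 2 = 2 * (m + 1)" and "2 * m + 3 = 2 * (m + 1) + 1"
    by simp_all
  then have list: "[triangular (2 * m + 1), triangular (2 * m + 2), triangular (2 * m + 3)]
      = ?e # map ((*) ?B) [m + 1, m + 1 + 1]"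
    by (simp only: triangular_double triangular_double_plus_1) simp
  have "coprime ?B (m + 1)"
  proof (rule coprimeI)
    fix d assume "d dvd ?B" "d dvd m + 1"
    then have "d dvd ?B - 2 * (m + 1)" by (metis dvd_diff_nat dvd_mult)
    then show "is_unit d" by simp
  qed
  moreover have "coprime ?B (2 * (m + 1) - 1)"
  proof (rule coprimeI)
    fix d assume d: "d dvd ?B" "d dvd 2 * (m + 1) - 1"
    then have "d dvd ?B - (2 * (m + 1) - 1)" by (metis dvd_diff_nat)
    then have "d dvd 2" by simp
    then have "d dvd ?B - 2 * (m + 1)" using d(1) by (metis dvd_diff_nat dvd_mult2)
    then show "is_unit d" by simp
  qed
  ultimately have "coprime ?e ?B"
    unfolding coprime_mult_left_iff by (simp only: coprime_commute)
  then have "frobenius (?e # map ((*) ?B) [m + 1, m + 1 + 1]) 2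
      = int ?B * (3 * int (m + 1) * int (m + 1) - 2 * int (m + 1) - 1) + int ?e * (int ?B - 1)"
    using assms by (intro frobenius_coprime_reduction denumerant_odd_case_le denumerant_odd_case_gt) auto
  also have "\<dots> = (5 * int m + 1) * (int m + 1) * (2 * int m + 3) - 1"
    by (simp add: algebra_simps)
  finally show ?thesis
    unfolding list .
qed

theorem theorem3:
  fixes n :: nat
  shows "(odd n \<and> n \<ge> 5 \<longrightarrow>
            real_of_int (frobenius [triangular n, triangular (n + 1), triangular (n + 2)] 2)
              = (5 * real n - 3) * (real n + 1) * (real n + 2) / 4 - 1)
       \<and> (even n \<and> n \<ge> 2 \<longrightarrow>
            real_of_int (frobenius [triangular n, triangular (n + 1), triangular (n + 2)] 2)
              = 5 * real n * (real n + 1) * (real n + 2) / 4 - 1)"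
proof (intro conjI impI)
  assume n: "odd n \<and> n \<ge> 5"
  then obtain m where m: "n = 2 * m + 1" by (elim conjE oddE)
  with n have "0 < m" by simp
  have "[triangular n, triangular (n + 1), triangular (n + 2)]
      = [triangular (2 * m + 1), triangular (2 * m + 2), triangular (2 * m + 3)]"
    by (simp add: m numeral_3_eq_3)
  then show "real_of_int (frobenius [triangular n, triangular (n + 1), triangular (n + 2)] 2)
      = (5 * real n - 3) * (real n + 1) * (real n + 2) / 4 - 1"
    \<comment> \<open>The denominator 4 cancels since \<open>5 n - 3 = 2 (5 m + 1)\<close> and
      \<open>n + 1 = 2 (m + 1)\<close>.\<close>
    by (simp only: frobenius_triangular_odd[OF \<open>0 < m\<close>]) (simp add: m field_simps)
next
  assume n: "even n \<and> n \<ge> 2"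
  then obtain m where m: "n = 2 * m" by (elim conjE evenE)
  with n have "0 < m" by simp
  then show "real_of_int (frobenius [triangular n, triangular (n + 1), triangular (n + 2)] 2)
      = 5 * real n * (real n + 1) * (real n + 2) / 4 - 1"
    unfolding m by (simp only: frobenius_triangular_even) (simp add: field_simps)
qed

end
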